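(* Let $V$ be a finite set and, for each $n\ge 1$, let $R_n$ be the jump rates of an irreducible $V$-valued continuous-time Markov chain. Assume that $\mathbb R_0(x,y):=\lim_{n\to\infty}R_n(x,y)\in[0,\infty)$ exists for all $x\ne y\in V$, and that $\mathbb R_0(x',y')>0$ for some $x'\neq y'\in V$. Then the sequence of functionals $\mathcal I_n\colon\mathcal P(V)\to[0,\infty)$ $\Gamma$-converges, as $n\to\infty$, to $\mathcal I^{(0)}\colon\mathcal P(V)\to[0,\infty)$.
   Context: $\mathcal P(V)$ is the set of probability measures on $V$ with the weak topology. With $(\mathcal L_nf)(x)=\sum_{y}R_n(x,y)[f(y)-f(x)]$ and $(\mathbb L^{(0)}f)(x)=\sum_{y}\mathbb R_0(x,y)[f(y)-f(x)]$ (the limiting chain may be reducible), define for $\mu\in\mathcal P(V)$ $$\mathcal I_n(\mu)=\sup_{H\colon V\to\mathbb R}-\sum_{x\in V}\mu(x)e^{-H(x)}(\mathcal L_ne^H)(x),\qquad \mathcal I^{(0)}(\mu)=\sup_{H\colon V\to\mathbb R}-\sum_{x\in V}\mu(x)e^{-H(x)}(\mathbb L^{(0)}e^H)(x).$$ $\Gamma$-convergence: functionals $U_n\colon\mathcal X\to[0,\infty]$ on a Polish space $\Gamma$-converge to $U$ if (i) for every $x$ and every $x_n\to x$, $\liminf_nU_n(x_n)\ge U(x)$; (ii) for every $x$ there is a sequence $x_n\to x$ with $\limsup_nU_n(x_n)\le U(x)$. *)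

theory Defs
  imports "HOL-Probability.Probability"
begin

text \<open>
  The state space is a type of class \<open>finite\<close>, regarded as a discrete space. Jump rates are a
  function \<open>R x y\<close>; only its off-diagonal values matter, and its diagonal is left unconstrained.
\<close>

definition jump_rates :: "('v::finite \<Rightarrow> 'v \<Rightarrow> real) \<Rightarrow> bool" where
  "jump_rates R \<longleftrightarrow> (\<forall>x y. x \<noteq> y \<longrightarrow> 0 \<le> R x y)"

definition irreducible_rates :: "('v::finite \<Rightarrow> 'v \<Rightarrow> real) \<Rightarrow> bool" where
  "irreducible_rates R \<longleftrightarrow> (\<forall>x y. (x, y) \<in> {(a, b). a \<noteq> b \<and> 0 < R a b}\<^sup>*)"

text \<open>The diagonal term \<open>y = x\<close> of the sum vanishes.\<close>

definition generator :: "('v::finite \<Rightarrow> 'v \<Rightarrow> real) \<Rightarrow> ('v \<Rightarrow> real) \<Rightarrow> 'v \<Rightarrow> real" where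
  "generator R f x = (\<Sum>y\<in>UNIV. R x y * (f y - f x))"

text \<open>The supremum is taken in the extended reals, so that no boundedness is presupposed.\<close>

definition rate_functional :: "('v::finite \<Rightarrow> 'v \<Rightarrow> real) \<Rightarrow> 'v pmf \<Rightarrow> ereal" where
  "rate_functional R \<mu> =
     (SUP H::'v \<Rightarrow> real.
        ereal (- (\<Sum>x\<in>UNIV. pmf \<mu> x * exp (- H x) * generator R (\<lambda>y. exp (H y)) x)))"

text \<open>
  The coarsest topology making \<open>\<mu> \<mapsto> \<integral> f d\<mu>\<close> continuous for every bounded \<open>f\<close>; every function
  on a discrete space is continuous.
\<close>

definition weak_topology :: "'v pmf topology" where
  "weak_topology = topology_generated_by
     {{\<mu>. measure_pmf.expectation \<mu> f \<in> U} | (f :: 'v \<Rightarrow> real) U. bounded (range f) \<and> open U}"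

lemma topspace_weak_topology [simp]: "topspace weak_topology = UNIV"
proof -
  have "UNIV \<in> {{\<mu>. measure_pmf.expectation \<mu> f \<in> U} | (f :: 'a \<Rightarrow> real) U. bounded (range f) \<and> open U}"
    by (auto intro!: exI[of _ "\<lambda>_. 0"] exI[of _ UNIV])
  then show ?thesis
    unfolding weak_topology_def topology_generated_by_topspace by blast
qed

lemma limitin_weak_topology_iff:
  "limitin weak_topology \<mu>s \<mu> F \<longleftrightarrow>
     (\<forall>f :: 'v \<Rightarrow> real. bounded (range f) \<longrightarrow>
        ((\<lambda>n. measure_pmf.expectation (\<mu>s n) f) \<longlongrightarrow> measure_pmf.expectation \<mu> f) F)"
  (is "?L \<longleftrightarrow> ?R")
proof
  assume L: ?L
  show ?R
  proof (intro allI impI topological_tendstoI)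
    fix f :: "'v \<Rightarrow> real" and U
    assume *: "bounded (range f)" "open U" "measure_pmf.expectation \<mu> f \<in> U"
    have "openin weak_topology {\<nu>. measure_pmf.expectation \<nu> f \<in> U}"
      unfolding weak_topology_def by (rule topology_generated_by_Basis) (use * in blast)
    with L * show "\<forall>\<^sub>F n in F. measure_pmf.expectation (\<mu>s n) f \<in> U"
      unfolding limitin_def by auto
  qed
next
  assume R: ?R
  have "\<mu> \<in> W \<longrightarrow> (\<forall>\<^sub>F n in F. \<mu>s n \<in> W)"
    if "generate_topology_on
      {{\<mu>. measure_pmf.expectation \<mu> f \<in> U} | (f :: 'v \<Rightarrow> real) U. bounded (range f) \<and> open U} W" for W
    using that
  proof induction
    case Empty
    then show ?case by simp
  next
    case (Int a b)
    then show ?case by (auto simp: eventually_conj)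
  next
    case (UN K)
    show ?case
    proof
      assume "\<mu> \<in> \<Union>K"
      then obtain k where k: "k \<in> K" "\<mu> \<in> k" by blast
      with UN have "\<forall>\<^sub>F n in F. \<mu>s n \<in> k" by blast
      then show "\<forall>\<^sub>F n in F. \<mu>s n \<in> \<Union>K"
        by (rule eventually_mono) (use k in blast)
    qed
  next
    case (Basis s)
    then obtain f :: "'v \<Rightarrow> real" and U where
      s: "s = {\<mu>. measure_pmf.expectation \<mu> f \<in> U}" "bounded (range f)" "open U" by blast
    with R have "((\<lambda>n. measure_pmf.expectation (\<mu>s n) f) \<longlongrightarrow> measure_pmf.expectation \<mu> f) F"
      by blast
    from topological_tendstoD[OF this s(3)] show ?case by (simp add: s(1))
  qed
  then show ?L
    unfolding limitin_def topspace_weak_topology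
    by (auto simp: weak_topology_def openin_topology_generated_by_iff)
qed

definition gamma_converges ::
  "'a topology \<Rightarrow> (nat \<Rightarrow> 'a \<Rightarrow> ereal) \<Rightarrow> ('a \<Rightarrow> ereal) \<Rightarrow> bool" where
  "gamma_converges X U U_lim \<longleftrightarrow>
     (\<forall>x\<in>topspace X. \<forall>xs. range xs \<subseteq> topspace X \<longrightarrow> limitin X xs x sequentially \<longrightarrow>
        U_lim x \<le> liminf (\<lambda>n. U n (xs n))) \<and>
     (\<forall>x\<in>topspace X. \<exists>xs. range xs \<subseteq> topspace X \<and> limitin X xs x sequentially \<and>
        limsup (\<lambda>n. U n (xs n)) \<le> U_lim x)"

end

(* Each H gives a functional that is linear in the rates and continuous in (rates, measure), so the
   supremum is lower semicontinuous and the liminf inequality follows. For the limsup inequality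
   the constant sequence is a recovery sequence: the rate functional is subadditive and positively
   homogeneous in the rates and at most the mean exit rate. Since R_n \<ge> (1 - e) R_0 off the
   diagonal for large n, splitting R_n = (1 - e) R_0 + (R_n - (1 - e) R_0) bounds I_n(\<mu>) by
   (1 - e) I_0(\<mu>) plus the mean exit rate of the remainder, which is of order e. *)

theory Submission imports Defs begin

text \<open>The quantity under the supremum for one fixed \<open>H\<close>, with the factor
  \<open>exp (- H x)\<close> multiplied into the differences. The inner sum omits the diagonal
  because signs and limits of the rates are given only for distinct states.\<close>

definition jump_functional :: "('v::finite \<Rightarrow> 'v \<Rightarrow> real) \<Rightarrow> 'v pmf \<Rightarrow> ('v \<Rightarrow> real) \<Rightarrow> real" where
  "jump_functional R \<mu> H = (\<Sum>x\<in>UNIV. \<Sum>y\<in>-{x}. pmf \<mu> x * R x y * (1 - exp (H y - H x)))"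

definition mean_exit_rate :: "('v::finite \<Rightarrow> 'v \<Rightarrow> real) \<Rightarrow> 'v pmf \<Rightarrow> real" where
  "mean_exit_rate R \<mu> = (\<Sum>x\<in>UNIV. \<Sum>y\<in>-{x}. pmf \<mu> x * R x y)"

lemma rate_functional_eq_SUP: "rate_functional R \<mu> = (SUP H. ereal (jump_functional R \<mu> H))"
proof -
  have "- (pmf \<mu> x * exp (- H x) * generator R (\<lambda>y. exp (H y)) x) =
    (\<Sum>y\<in>-{x}. pmf \<mu> x * R x y * (1 - exp (H y - H x)))" for x and H :: "'a \<Rightarrow> real"
  proof -
    have "generator R (\<lambda>y. exp (H y)) x = (\<Sum>y\<in>-{x}. R x y * (exp (H y) - exp (H x)))"
      unfolding generator_def by (rule sum.mono_neutral_right) auto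
    then show ?thesis
      by (simp only: sum_distrib_left sum_negf[symmetric])
        (intro sum.cong refl, simp add: exp_diff exp_minus field_simps)
  qed
  then show ?thesis
    unfolding rate_functional_def jump_functional_def by (simp only: sum_negf[symmetric])
qed

lemma jump_functional_le_rate_functional:
  "ereal (jump_functional R \<mu> H) \<le> rate_functional R \<mu>"
  unfolding rate_functional_eq_SUP by (rule SUP_upper) simp

lemma rate_functional_leI:
  assumes "\<And>H. ereal (jump_functional R \<mu> H) \<le> c"
  shows "rate_functional R \<mu> \<le> c"
  unfolding rate_functional_eq_SUP using assms by (rule SUP_least)

lemma rate_functional_nonneg: "0 \<le> rate_functional R \<mu>"
  using jump_functional_le_rate_functional[of R \<mu> "\<lambda>_. 0"]
  by (simp add: jump_functional_def flip: zero_ereal_def)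

text \<open>Each factor \<open>1 - exp (H y - H x)\<close> is below 1 and its weight is nonnegative.
  The bound does not depend on \<open>H\<close>, so it passes to the supremum.\<close>

lemma jump_functional_le_mean_exit_rate:
  assumes "jump_rates R"
  shows "jump_functional R \<mu> H \<le> mean_exit_rate R \<mu>"
  unfolding jump_functional_def mean_exit_rate_def
  using assms by (intro sum_mono mult_left_le) (auto simp: jump_rates_def)

lemma rate_functional_finite:
  assumes "jump_rates R"
  shows "rate_functional R \<mu> < \<infinity>"
proof -
  have "rate_functional R \<mu> \<le> ereal (mean_exit_rate R \<mu>)"
    using jump_functional_le_mean_exit_rate[OF assms] by (intro rate_functional_leI) simp
  then show ?thesis
    by (rule le_less_trans) simp
qed

lemma jump_functional_linear:
  "jump_functional (\<lambda>x y. R x y - c * S x y) \<mu> H =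
     jump_functional R \<mu> H - c * jump_functional S \<mu> H"
  unfolding jump_functional_def sum_distrib_left sum_subtractf[symmetric]
  by (intro sum.cong refl) (simp add: algebra_simps)

lemma mean_exit_rate_linear:
  "mean_exit_rate (\<lambda>x y. R x y - c * S x y) \<mu> = mean_exit_rate R \<mu> - c * mean_exit_rate S \<mu>"
  unfolding mean_exit_rate_def sum_distrib_left sum_subtractf[symmetric]
  by (intro sum.cong refl) (simp add: algebra_simps)

text \<open>Write \<open>R\<close> as \<open>c * S\<close> plus a remainder with nonnegative rates.
  At each \<open>H\<close> the first part contributes at most \<open>c * r\<close>, and the
  remainder at most its mean exit rate, which is linear in the rates.\<close>

lemma rate_functional_le_of_rates_ge:
  assumes "0 \<le> c" and "jump_rates (\<lambda>x y. R x y - c * S x y)" and "rate_functional S \<mu> = ereal r"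
  shows "rate_functional R \<mu> \<le> ereal (mean_exit_rate R \<mu> - c * mean_exit_rate S \<mu> + c * r)"
proof (rule rate_functional_leI)
  fix H
  have "jump_functional S \<mu> H \<le> r"
    using jump_functional_le_rate_functional[of S \<mu> H] assms(3) by simp
  then have "c * jump_functional S \<mu> H \<le> c * r"
    using assms(1) by (rule mult_left_mono)
  moreover have "jump_functional R \<mu> H - c * jump_functional S \<mu> H
      \<le> mean_exit_rate R \<mu> - c * mean_exit_rate S \<mu>"
    using jump_functional_le_mean_exit_rate[OF assms(2)]
    by (simp add: jump_functional_linear mean_exit_rate_linear)
  ultimately show "ereal (jump_functional R \<mu> H)
      \<le> ereal (mean_exit_rate R \<mu> - c * mean_exit_rate S \<mu> + c * r)"
    by simp
qed

text \<open>The indicator of a single point is a bounded test function, and its expectation is the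
  mass of that point.\<close>

lemma limitin_weak_topology_imp_pmf_tendsto:
  assumes "limitin weak_topology \<mu>s \<mu> F"
  shows "((\<lambda>n. pmf (\<mu>s n) x) \<longlongrightarrow> pmf \<mu> x) F"
proof -
  have "bounded (range (indicat_real {x}))"
    by (rule boundedI[of _ 1]) (auto simp: indicator_def)
  then have "((\<lambda>n. measure_pmf.expectation (\<mu>s n) (indicat_real {x}))
      \<longlongrightarrow> measure_pmf.expectation \<mu> (indicat_real {x})) F"
    by (rule assms[unfolded limitin_weak_topology_iff, rule_format])
  then show ?thesis
    by (simp add: measure_pmf_single)
qed

text \<open>A positive limit leaves a gap between \<open>c * l\<close> and \<open>l\<close>, which
  convergence exploits. At \<open>l = 0\<close> there is no gap, and nonnegativity of
  \<open>f\<close> takes over; this covers jumps whose rates vanish in the limit.\<close>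

lemma eventually_scaled_limit_le:
  fixes f :: "nat \<Rightarrow> real"
  assumes "f \<longlonglongrightarrow> l" and "\<And>n. 1 \<le> n \<Longrightarrow> 0 \<le> f n" and "c < 1"
  shows "\<forall>\<^sub>F n in sequentially. c * l \<le> f n"
proof (cases "l = 0")
  case True
  then show ?thesis
    using assms(2) by (intro eventually_sequentiallyI[of 1]) simp
next
  case False
  have "0 \<le> l"
    using assms(1,2) by (intro LIMSEQ_le_const) auto
  with False assms(3) have "c * l < l" by simp
  then have "\<forall>\<^sub>F n in sequentially. c * l < f n"
    using assms(1) by (rule order_tendstoD(1)[rotated])
  then show ?thesis
    by (rule eventually_mono) simp
qed

lemma rate_functional_liminf:
  assumes "\<And>x y. x \<noteq> y \<Longrightarrow> (\<lambda>n. R n x y) \<longlonglongrightarrow> S x y"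
    and "limitin weak_topology \<mu>s \<mu> sequentially"
  shows "rate_functional S \<mu> \<le> liminf (\<lambda>n. rate_functional (R n) (\<mu>s n))"
proof (rule rate_functional_leI)
  fix H
  \<comment> \<open>With \<open>H\<close> fixed this is a finite sum of products of masses, rates
    and constants, so rates and measures may vary together.\<close>
  have "(\<lambda>n. jump_functional (R n) (\<mu>s n) H) \<longlonglongrightarrow> jump_functional S \<mu> H"
    unfolding jump_functional_def
    by (intro tendsto_intros limitin_weak_topology_imp_pmf_tendsto assms) auto
  then have "ereal (jump_functional S \<mu> H) = liminf (\<lambda>n. ereal (jump_functional (R n) (\<mu>s n) H))"
    by (intro lim_imp_Liminf[symmetric]) auto
  also have "\<dots> \<le> liminf (\<lambda>n. rate_functional (R n) (\<mu>s n))"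
    by (intro Liminf_mono always_eventually allI jump_functional_le_rate_functional)
  finally show "ereal (jump_functional S \<mu> H) \<le> \<dots>" .
qed

lemma rate_functional_limsup:
  assumes "\<And>x y. x \<noteq> y \<Longrightarrow> (\<lambda>n. R n x y) \<longlonglongrightarrow> S x y"
    and "\<And>n. 1 \<le> n \<Longrightarrow> jump_rates (R n)" and "jump_rates S"
  shows "limsup (\<lambda>n. rate_functional (R n) \<mu>) \<le> rate_functional S \<mu>"
proof -
  \<comment> \<open>A finite value keeps the following estimates in real arithmetic.\<close>
  obtain r where r: "rate_functional S \<mu> = ereal r"
    using rate_functional_nonneg[of S \<mu>] rate_functional_finite[OF assms(3), of \<mu>]
    by (cases "rate_functional S \<mu>") auto
  let ?C = "mean_exit_rate S \<mu>"
  \<comment> \<open>Two limits are taken in turn: first \<open>n\<close> grows with \<open>c\<close>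
    fixed, then \<open>c\<close> increases to 1.\<close>
  have bound: "limsup (\<lambda>n. rate_functional (R n) \<mu>) \<le> ereal (?C - c * ?C + c * r)"
    if c: "0 < c" "c < 1" for c
  proof -
    \<comment> \<open>The condition \<open>x \<noteq> y\<close> stays inside the eventuality, so
      that the finitely many pairs can be merged into one threshold for \<open>n\<close>.\<close>
    have "\<forall>\<^sub>F n in sequentially. x \<noteq> y \<longrightarrow> c * S x y \<le> R n x y" for x y
      using eventually_scaled_limit_le[OF assms(1) _ c(2), of x y] assms(2)
      by (cases "x = y") (auto simp: jump_rates_def)
    then have "\<forall>\<^sub>F n in sequentially. \<forall>x y. x \<noteq> y \<longrightarrow> c * S x y \<le> R n x y"
      by (intro eventually_all_finite)
    then have "\<forall>\<^sub>F n in sequentially.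
        rate_functional (R n) \<mu> \<le> ereal (mean_exit_rate (R n) \<mu> - c * ?C + c * r)"
    proof (rule eventually_mono)
      fix n
      assume "\<forall>x y. x \<noteq> y \<longrightarrow> c * S x y \<le> R n x y"
      then have "jump_rates (\<lambda>x y. R n x y - c * S x y)"
        by (simp add: jump_rates_def)
      with c(1) show "rate_functional (R n) \<mu> \<le> ereal (mean_exit_rate (R n) \<mu> - c * ?C + c * r)"
        using r by (intro rate_functional_le_of_rates_ge) simp_all
    qed
    then have "limsup (\<lambda>n. rate_functional (R n) \<mu>)
        \<le> limsup (\<lambda>n. ereal (mean_exit_rate (R n) \<mu> - c * ?C + c * r))"
      by (rule Limsup_mono)
    also have "(\<lambda>n. mean_exit_rate (R n) \<mu> - c * ?C + c * r) \<longlonglongrightarrow> ?C - c * ?C + c * r"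
      unfolding mean_exit_rate_def by (intro tendsto_intros assms(1)) auto
    then have "limsup (\<lambda>n. ereal (mean_exit_rate (R n) \<mu> - c * ?C + c * r))
        = ereal (?C - c * ?C + c * r)"
      by (intro lim_imp_Limsup) auto
    finally show ?thesis .
  qed
  \<comment> \<open>The excess \<open>(1 - c) * ?C\<close> disappears as \<open>c\<close> tends to
    1, leaving \<open>r\<close>.\<close>
  have "((\<lambda>c. ?C - c * ?C + c * r) \<longlongrightarrow> ?C - 1 * ?C + 1 * r) (at_left 1)"
    by (intro tendsto_intros)
  then have "((\<lambda>c. ereal (?C - c * ?C + c * r)) \<longlongrightarrow> rate_functional S \<mu>) (at_left 1)"
    by (simp add: r)
  moreover have "\<forall>\<^sub>F c in at_left 1.
      limsup (\<lambda>n. rate_functional (R n) \<mu>) \<le> ereal (?C - c * ?C + c * r)"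
    by (rule eventually_at_leftI[of 0]) (auto intro: bound)
  ultimately show ?thesis
    by (rule tendsto_lowerbound) simp
qed

theorem proposition2p1:
  fixes R :: "nat \<Rightarrow> 'v::finite \<Rightarrow> 'v \<Rightarrow> real"
    and R\<^sub>0 :: "'v \<Rightarrow> 'v \<Rightarrow> real"
  assumes "\<And>n. 1 \<le> n \<Longrightarrow> jump_rates (R n)"
    and "\<And>n. 1 \<le> n \<Longrightarrow> irreducible_rates (R n)"
    and "\<And>x y. x \<noteq> y \<Longrightarrow> (\<lambda>n. R n x y) \<longlonglongrightarrow> R\<^sub>0 x y"
    and "\<exists>x' y'. x' \<noteq> y' \<and> 0 < R\<^sub>0 x' y'"
  shows "(\<forall>n\<ge>1. \<forall>\<mu>. 0 \<le> rate_functional (R n) \<mu> \<and> rate_functional (R n) \<mu> < \<infinity>) \<and>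
         (\<forall>\<mu>. 0 \<le> rate_functional R\<^sub>0 \<mu> \<and> rate_functional R\<^sub>0 \<mu> < \<infinity>) \<and>
         gamma_converges weak_topology (\<lambda>n. rate_functional (R n)) (rate_functional R\<^sub>0)"
proof -
  \<comment> \<open>Nonnegativity survives the limit; the comparison starts at \<open>n = 1\<close>
    because nothing is assumed about the sign of \<open>R 0\<close>.\<close>
  have R\<^sub>0: "jump_rates R\<^sub>0"
    unfolding jump_rates_def
  proof (intro allI impI)
    fix x y :: 'v
    assume "x \<noteq> y"
    then have "\<forall>n\<ge>1. 0 \<le> R n x y"
      using assms(1) by (simp add: jump_rates_def)
    then show "0 \<le> R\<^sub>0 x y"
      by (intro LIMSEQ_le_const[OF assms(3)[OF \<open>x \<noteq> y\<close>]] exI)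
  qed
  have "gamma_converges weak_topology (\<lambda>n. rate_functional (R n)) (rate_functional R\<^sub>0)"
    unfolding gamma_converges_def
  proof (intro conjI ballI allI impI)
    fix \<mu> :: "'v pmf" and \<mu>s
    assume "limitin weak_topology \<mu>s \<mu> sequentially"
    with assms(3) show "rate_functional R\<^sub>0 \<mu> \<le> liminf (\<lambda>n. rate_functional (R n) (\<mu>s n))"
      by (rule rate_functional_liminf)
  next
    fix \<mu> :: "'v pmf"
    have "limsup (\<lambda>n. rate_functional (R n) \<mu>) \<le> rate_functional R\<^sub>0 \<mu>"
      using assms(3,1) R\<^sub>0 by (rule rate_functional_limsup)
    then show "\<exists>\<mu>s. range \<mu>s \<subseteq> topspace weak_topology \<and> limitin weak_topology \<mu>s \<mu> sequentially \<and>
        limsup (\<lambda>n. rate_functional (R n) (\<mu>s n)) \<le> rate_functional R\<^sub>0 \<mu>"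
      by (intro exI[of _ "\<lambda>_. \<mu>"]) (simp add: limitin_weak_topology_iff)
  qed
  then show ?thesis
    by (intro conjI allI impI rate_functional_nonneg rate_functional_finite assms(1) R\<^sub>0)
qed

end
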